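(* Let $n$ be odd and let $G$ be a finite connected graph with a harmonic action of $D_n=\langle\sigma_1,\sigma_2\rangle$ as described in the context, with vertices labeled $z_i^j$ ($1\le j\le s$) and $x_i^j,y_i^j$ ($1\le j\le t$), $i\in\{1,\dots,n\}$. Let $\delta$ be a divisor of degree zero on $G$. Then $\delta\in\mathcal{P}=\mathcal{P}_1+\mathcal{P}_2+\mathcal{P}_3$ if and only if: (1) $\sum_{i=1}^n i\,(X_i+Y_i+Z_i)\equiv 0\pmod n$, where $X_i=\sum_{j=1}^t\delta(x_i^j)$, $Y_i=\sum_{j=1}^t\delta(y_i^j)$, $Z_i=\sum_{j=1}^s\delta(z_i^j)$; and (2) for each $j=1,\dots,t$, $\sum_{i=1}^n\delta(x_i^j)\equiv\sum_{i=1}^n\delta(y_i^j)\pmod n$.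
   Context: Graphs are finite, connected, may have multiple edges, no loops. A divisor on $G$ is a function from the vertex set to $\mathbb{Z}$; its degree is the sum of its values. Setting: $D_n$ is the dihedral group of order $2n$ generated by involutions $\sigma_1,\sigma_2$, acting on $G$ by automorphisms harmonically (no non-identity element fixes both endpoints of an edge), and every $D_n$-orbit of vertices has $n$ or $2n$ points. The vertices are labeled so that there are $s$ orbits of size $n$, $\{z_i^j: i=1,\dots,n\}$ for $j=1,\dots,s$, and $t$ orbits of size $2n$, $\{x_i^j,y_i^j\}$ for $j=1,\dots,t$, with (subscripts mod $n$) $\sigma_1(z_i^j)=z_{n+1-i}^j$, $\sigma_1(x_i^j)=y_{n+1-i}^j$, $\sigma_1(y_i^j)=x_{n+1-i}^j$, $\sigma_2(z_i^j)=z_{n+2-i}^j$, $\sigma_2(x_i^j)=y_{n+2-i}^j$, $\sigma_2(y_i^j)=x_{n+2-i}^j$. For a subgroup $\Gamma$ the quotient graph $G/\Gamma$ has vertices the $\Gamma$-orbits of vertices and edges the $\Gamma$-orbits of edges, quotient map $\phi$; the pullback of a divisor $\hat D$ on $G/\Gamma$ is $\phi^*(\hat D)(v)=|\mathrm{Stab}_\Gamma(v)|\,\hat D(\phi(v))$. Let $H_1=G/\langle\sigma_1\rangle$, $H_2=G/\langle\sigma_2\rangle$, $H_3=G/\langle\sigma_1\sigma_2\rangle$, let $\mathcal{P}_k$ be the set of divisors $\phi_k^*(\hat D)$ with $\hat D$ of degree zero on $H_k$, and $\mathcal{P}_1+\mathcal{P}_2+\mathcal{P}_3$ the set of sums $\delta_1+\delta_2+\delta_3$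 with $\delta_k\in\mathcal{P}_k$. *)

theory Defs
  imports
    "HOL-Algebra.Group_Action"
    "HOL-Algebra.Elementary_Groups"
    "HOL-Number_Theory.Cong"
begin

text \<open>
  Undirected graphs with possible multiple edges: each edge is sent to the set of its endpoints.
  A loop would be an edge whose set of endpoints is a singleton; the record type itself admits
  these, because they can arise in a quotient.
\<close>

record ('v, 'e) multigraph =
  verts :: "'v set"
  edges :: "'e set"
  ends :: "'e \<Rightarrow> 'v set"

definition adj_rel :: "('v, 'e) multigraph \<Rightarrow> 'v rel" where
  "adj_rel G = {(u, v). \<exists>e\<in>edges G. ends G e = {u, v}}"

definition connected_graph :: "('v, 'e) multigraph \<Rightarrow> bool" where
  "connected_graph G \<longleftrightarrow>
     verts G \<noteq> {} \<and> (\<forall>u\<in>verts G. \<forall>v\<in>verts G. (u, v) \<in> (adj_rel G)\<^sup>*)"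

definition finite_loopless_graph :: "('v, 'e) multigraph \<Rightarrow> bool" where
  "finite_loopless_graph G \<longleftrightarrow>
     finite (verts G) \<and> finite (edges G) \<and>
     (\<forall>e\<in>edges G. ends G e \<subseteq> verts G \<and> card (ends G e) = 2)"

definition graph_action ::
  "('g, 'm) monoid_scheme \<Rightarrow> ('v, 'e) multigraph \<Rightarrow> ('g \<Rightarrow> 'v \<Rightarrow> 'v) \<Rightarrow> ('g \<Rightarrow> 'e \<Rightarrow> 'e) \<Rightarrow> bool"
where
  "graph_action \<Gamma> G \<phi> \<psi> \<longleftrightarrow>
     group_action \<Gamma> (verts G) \<phi> \<and> group_action \<Gamma> (edges G) \<psi> \<and>
     (\<forall>g\<in>carrier \<Gamma>. \<forall>e\<in>edges G. ends G (\<psi> g e) = \<phi> g ` ends G e)"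

definition harmonic_action ::
  "('g, 'm) monoid_scheme \<Rightarrow> ('v, 'e) multigraph \<Rightarrow> ('g \<Rightarrow> 'v \<Rightarrow> 'v) \<Rightarrow> ('g \<Rightarrow> 'e \<Rightarrow> 'e) \<Rightarrow> bool"
where
  "harmonic_action \<Gamma> G \<phi> \<psi> \<longleftrightarrow>
     graph_action \<Gamma> G \<phi> \<psi> \<and>
     (\<forall>g\<in>carrier \<Gamma>. \<forall>e\<in>edges G. (\<forall>v\<in>ends G e. \<phi> g v = v) \<longrightarrow> g = \<one>\<^bsub>\<Gamma>\<^esub>)"

definition dihedral_group :: "('g, 'm) monoid_scheme \<Rightarrow> nat \<Rightarrow> 'g \<Rightarrow> 'g \<Rightarrow> bool" where
  "dihedral_group D n \<sigma>\<^sub>1 \<sigma>\<^sub>2 \<longleftrightarrow>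
     group D \<and> order D = 2 * n \<and>
     \<sigma>\<^sub>1 \<in> carrier D \<and> \<sigma>\<^sub>1 \<noteq> \<one>\<^bsub>D\<^esub> \<and> \<sigma>\<^sub>1 \<otimes>\<^bsub>D\<^esub> \<sigma>\<^sub>1 = \<one>\<^bsub>D\<^esub> \<and>
     \<sigma>\<^sub>2 \<in> carrier D \<and> \<sigma>\<^sub>2 \<noteq> \<one>\<^bsub>D\<^esub> \<and> \<sigma>\<^sub>2 \<otimes>\<^bsub>D\<^esub> \<sigma>\<^sub>2 = \<one>\<^bsub>D\<^esub> \<and>
     generate D {\<sigma>\<^sub>1, \<sigma>\<^sub>2} = carrier D"

text \<open>
  The endpoints of an edge orbit are the orbits of the endpoints of any of its members; the union
  over all members avoids choosing a representative.
\<close>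

definition quotient_graph ::
  "('g, 'm) monoid_scheme \<Rightarrow> ('v, 'e) multigraph \<Rightarrow> ('g \<Rightarrow> 'v \<Rightarrow> 'v) \<Rightarrow> ('g \<Rightarrow> 'e \<Rightarrow> 'e)
     \<Rightarrow> ('v set, 'e set) multigraph"
where
  "quotient_graph \<Gamma> G \<phi> \<psi> =
     \<lparr>verts = orbits \<Gamma> (verts G) \<phi>,
      edges = orbits \<Gamma> (edges G) \<psi>,
      ends = (\<lambda>E. orbit \<Gamma> \<phi> ` (\<Union>e\<in>E. ends G e))\<rparr>"

text \<open>
  A function on the vertex set is represented by its extension by zero, so that equality of
  divisors is equality of functions.
\<close>

definition divisors :: "('v, 'e) multigraph \<Rightarrow> ('v \<Rightarrow> int) set" where
  "divisors G = {\<delta>. \<forall>v. v \<notin> verts G \<longrightarrow> \<delta> v = 0}"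

definition divisor_degree :: "('v, 'e) multigraph \<Rightarrow> ('v \<Rightarrow> int) \<Rightarrow> int" where
  "divisor_degree G \<delta> = (\<Sum>v\<in>verts G. \<delta> v)"

definition pullback ::
  "('g, 'm) monoid_scheme \<Rightarrow> ('v, 'e) multigraph \<Rightarrow> ('g \<Rightarrow> 'v \<Rightarrow> 'v) \<Rightarrow> ('v set \<Rightarrow> int) \<Rightarrow> 'v \<Rightarrow> int"
where
  "pullback \<Gamma> G \<phi> \<delta> =
     (\<lambda>v. if v \<in> verts G then int (card (stabilizer \<Gamma> \<phi> v)) * \<delta> (orbit \<Gamma> \<phi> v) else 0)"

definition pullbacks_deg0 ::
  "('g, 'm) monoid_scheme \<Rightarrow> ('v, 'e) multigraph \<Rightarrow> ('g \<Rightarrow> 'v \<Rightarrow> 'v) \<Rightarrow> ('g \<Rightarrow> 'e \<Rightarrow> 'e)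
     \<Rightarrow> ('v \<Rightarrow> int) set"
where
  "pullbacks_deg0 \<Gamma> G \<phi> \<psi> =
     {pullback \<Gamma> G \<phi> \<delta> | \<delta>.
        \<delta> \<in> divisors (quotient_graph \<Gamma> G \<phi> \<psi>) \<and>
        divisor_degree (quotient_graph \<Gamma> G \<phi> \<psi>) \<delta> = 0}"

definition pullback_sum ::
  "('g, 'm) monoid_scheme \<Rightarrow> 'g \<Rightarrow> 'g \<Rightarrow> ('v, 'e) multigraph \<Rightarrow> ('g \<Rightarrow> 'v \<Rightarrow> 'v) \<Rightarrow> ('g \<Rightarrow> 'e \<Rightarrow> 'e)
     \<Rightarrow> ('v \<Rightarrow> int) set"
where
  "pullback_sum D \<sigma>\<^sub>1 \<sigma>\<^sub>2 G \<phi> \<psi> =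
     {(\<lambda>v. \<delta>\<^sub>1 v + \<delta>\<^sub>2 v + \<delta>\<^sub>3 v) | \<delta>\<^sub>1 \<delta>\<^sub>2 \<delta>\<^sub>3.
        \<delta>\<^sub>1 \<in> pullbacks_deg0 (subgroup_generated D {\<sigma>\<^sub>1}) G \<phi> \<psi> \<and>
        \<delta>\<^sub>2 \<in> pullbacks_deg0 (subgroup_generated D {\<sigma>\<^sub>2}) G \<phi> \<psi> \<and>
        \<delta>\<^sub>3 \<in> pullbacks_deg0 (subgroup_generated D {\<sigma>\<^sub>1 \<otimes>\<^bsub>D\<^esub> \<sigma>\<^sub>2}) G \<phi> \<psi>}"

text \<open>
  Subscripts modulo \<open>n\<close> are integers, with labels periodic of period \<open>n\<close> in the subscript. That the
  \<open>n\<close> (resp. \<open>2n\<close>) labels of an orbit are distinct is contained in the cardinalities of the orbits.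
\<close>

definition dihedral_labelling ::
  "('g, 'm) monoid_scheme \<Rightarrow> nat \<Rightarrow> 'g \<Rightarrow> 'g \<Rightarrow> ('v, 'e) multigraph \<Rightarrow> ('g \<Rightarrow> 'v \<Rightarrow> 'v)
     \<Rightarrow> nat \<Rightarrow> nat \<Rightarrow> (int \<Rightarrow> nat \<Rightarrow> 'v) \<Rightarrow> (int \<Rightarrow> nat \<Rightarrow> 'v) \<Rightarrow> (int \<Rightarrow> nat \<Rightarrow> 'v) \<Rightarrow> bool"
where
  "dihedral_labelling D n \<sigma>\<^sub>1 \<sigma>\<^sub>2 G \<phi> s t z x y \<longleftrightarrow>
     bij_betw (\<lambda>j. {z i j | i. i \<in> {1..int n}})
       {1..s} {B \<in> orbits D (verts G) \<phi>. card B = n} \<and>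
     bij_betw (\<lambda>j. {x i j | i. i \<in> {1..int n}} \<union> {y i j | i. i \<in> {1..int n}})
       {1..t} {B \<in> orbits D (verts G) \<phi>. card B = 2 * n} \<and>
     (\<forall>j\<in>{1..s}. \<forall>i.
        z (i + int n) j = z i j \<and>
        \<phi> \<sigma>\<^sub>1 (z i j) = z (int n + 1 - i) j \<and>
        \<phi> \<sigma>\<^sub>2 (z i j) = z (int n + 2 - i) j) \<and>
     (\<forall>j\<in>{1..t}. \<forall>i.
        x (i + int n) j = x i j \<and> y (i + int n) j = y i j \<and>
        \<phi> \<sigma>\<^sub>1 (x i j) = y (int n + 1 - i) j \<and> \<phi> \<sigma>\<^sub>1 (y i j) = x (int n + 1 - i) j \<and>
        \<phi> \<sigma>\<^sub>2 (x i j) = y (int n + 2 - i) j \<and> \<phi> \<sigma>\<^sub>2 (y i j) = x (int n + 2 - i) j)"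

end

theory Submission
  imports
    Defs
    "HOL-Library.Function_Algebras"
    "HOL-Library.Indicator_Function"
    "HOL-Library.Periodic_Fun"
    "HOL-Library.Set_Algebras"
begin

text \<open>
  Let \<open>\<A>\<^sub>k\<close> be the group of pullbacks to \<open>G\<close> of divisors of any degree on \<open>H\<^sub>k\<close>, let
  \<open>\<A> = \<A>\<^sub>1 + \<A>\<^sub>2 + \<A>\<^sub>3\<close>, and let the weight of a divisor be the left-hand side of condition (1).

  The group \<open>\<A>\<close> consists of the divisors that satisfy condition (2). Indeed, for every divisor \<open>f\<close>
  both \<open>f + f \<circ> \<sigma>\<^sub>1\<close> and \<open>f + f \<circ> \<sigma>\<^sub>2\<close> lie in \<open>\<A>\<close>, so that \<open>f\<close> is congruent modulo \<open>\<A>\<close> to its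
  translates by rotations, and \<open>n f\<close> is congruent to the sum of these translates, which lies in
  \<open>\<A>\<^sub>3\<close>. Consequently \<open>\<A>\<close> contains every divisor whose sums over the cycles \<open>x\<^sup>j\<close>, \<open>y\<^sup>j\<close>, \<open>z\<^sup>j\<close> are
  divisible by \<open>n\<close>. If \<open>f\<close> satisfies condition (2), then \<open>f - f \<circ> \<sigma>\<^sub>1\<close> is such a divisor; hence \<open>\<A>\<close>
  contains \<open>2 f\<close> and \<open>n f\<close>, and thus \<open>f\<close>.

  The reflection \<open>\<sigma>\<^sub>k\<close> sends the index \<open>i\<close> to \<open>k - i\<close>, so twice the weight of a divisor in \<open>\<A>\<^sub>k\<close> is
  \<open>k\<close> times its degree modulo \<open>n\<close> for \<open>k = 1, 2\<close>; it is \<open>0\<close> for \<open>k = 3\<close>. If \<open>f\<^sub>1 + f\<^sub>2 + f\<^sub>3\<close> with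
  \<open>f\<^sub>k \<in> \<A>\<^sub>k\<close> has degree \<open>0\<close>, then its weight vanishes modulo \<open>n\<close> only if \<open>2 n\<close> divides the degrees of
  all three summands. The pullback of a point of \<open>G / D\<^sub>n\<close> has degree \<open>2 n\<close> and lies in each \<open>\<A>\<^sub>k\<close>, so
  that shifting multiples of it between the summands makes their degrees vanish.
\<close>

section \<open>Integer-valued functions as a module\<close>

definition int_scale :: "int \<Rightarrow> ('a \<Rightarrow> int) \<Rightarrow> 'a \<Rightarrow> int"  (infixr \<open>*\<^sub>z\<close> 75)
  where "c *\<^sub>z f = (\<lambda>v. c * f v)"

lemma int_scale_apply [simp]: "(c *\<^sub>z f) v = c * f v"
  by (simp add: int_scale_def)

lemma sum_fun_apply: "(\<Sum>i\<in>I. f i) v = (\<Sum>i\<in>I. f i v)"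
  by (induction I rule: infinite_finite_induct) simp_all

interpretation int_fun: module int_scale
  by standard (auto simp: algebra_simps)

lemma (in module) subspace_set_plus:
  assumes "subspace A" and "subspace B"
  shows "subspace (A + B)"
proof (rule subspaceI)
  show "0 \<in> A + B"
    using set_plus_intro[OF subspace_0 subspace_0] assms by fastforce
next
  fix u v assume "u \<in> A + B" and "v \<in> A + B"
  then obtain a b a' b' where "u = a + b" "v = a' + b'" "a \<in> A" "a' \<in> A" "b \<in> B" "b' \<in> B"
    by (elim set_plus_elim)
  moreover have "(a + b) + (a' + b') = (a + a') + (b + b')"
    by simp
  ultimately show "u + v \<in> A + B"
    using assms subspace_add by (metis set_plus_intro)
next
  fix c u assume "u \<in> A + B"
  then obtain a b where "u = a + b" "a \<in> A" "b \<in> B"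
    by (elim set_plus_elim)
  then show "scale c u \<in> A + B"
    using assms by (simp add: scale_right_distrib set_plus_intro subspace_scale)
qed

section \<open>Divisors\<close>

lemma divisor_degree_add: "divisor_degree G (f + g) = divisor_degree G f + divisor_degree G g"
  by (simp add: divisor_degree_def sum.distrib)

lemma divisor_degree_diff_scale:
  "divisor_degree G (f - c *\<^sub>z g) = divisor_degree G f - c * divisor_degree G g"
  by (simp add: divisor_degree_def sum_subtractf sum_distrib_left)

lemma indicator_in_divisors: "v \<in> verts G \<Longrightarrow> indicator {v} \<in> divisors G"
  by (auto simp: divisors_def indicator_def)

lemma divisor_eq_sum_indicators:
  assumes "finite (verts G)" and "f \<in> divisors G"
  shows "f = (\<Sum>v\<in>verts G. f v *\<^sub>z indicator {v})"
proof
  fix w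
  have "(\<Sum>v\<in>verts G. f v * indicator {v} w) = (\<Sum>v\<in>verts G. if v = w then f v else 0)"
    by (intro sum.cong) (auto simp: indicator_def)
  then show "f w = (\<Sum>v\<in>verts G. f v *\<^sub>z indicator {v}) w"
    using assms by (simp add: divisors_def sum_fun_apply)
qed

section \<open>Sums of periodic functions\<close>

lemma periodic_fun_cong:
  fixes f :: "int \<Rightarrow> 'a"
  assumes "periodic_fun_simple f m" and "[i = k] (mod m)"
  shows "f i = f k"
proof -
  interpret periodic_fun_simple f m by fact
  from assms(2) obtain c where "k = i + m * c"
    by (auto simp: cong_iff_lin)
  then show ?thesis
    using plus_of_int[of i c] by (simp add: mult.commute)
qed

lemma sum_periodic_reflect:
  fixes f :: "int \<Rightarrow> 'a :: comm_monoid_add"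
  assumes "periodic_fun_simple f m" and "m > 0"
  shows "(\<Sum>i=1..m. f (c - i)) = (\<Sum>i=1..m. f i)"
proof -
  define rep where "rep i = (i - 1) mod m + 1" for i
  have rep_range: "rep i \<in> {1..m}" and rep_cong: "[rep i = i] (mod m)" for i
    using \<open>m > 0\<close> by (auto simp: rep_def add1_zle_eq cong_def mod_simps)
  have rep_unique: "rep i = k" if "k \<in> {1..m}" "[i = k] (mod m)" for i k
  proof -
    have "(i - 1) mod m = (k - 1) mod m"
      using cong_diff[OF that(2) cong_refl] by (simp add: cong_def)
    then show ?thesis using that(1) by (simp add: rep_def)
  qed
  have rep_reflect: "rep (c - rep (c - i)) = i" if "i \<in> {1..m}" for i
    using cong_diff[OF cong_refl rep_cong[of "c - i"], of c] that by (intro rep_unique) simp_all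
  then have "bij_betw (\<lambda>i. rep (c - i)) {1..m} {1..m}"
    by (intro bij_betw_byWitness[where f' = "\<lambda>i. rep (c - i)"]) (use rep_range in auto)
  then have "(\<Sum>i=1..m. f (rep (c - i))) = (\<Sum>i=1..m. f i)"
    by (rule sum.reindex_bij_betw)
  moreover have "f (rep i) = f i" for i
    by (rule periodic_fun_cong[OF assms(1) rep_cong])
  ultimately show ?thesis
    by simp
qed

lemma weighted_sum_periodic_reflect:
  fixes f :: "int \<Rightarrow> int"
  assumes "periodic_fun_simple f m" and "m > 0"
  shows "[(\<Sum>i=1..m. (c - i) * f (c - i)) = (\<Sum>i=1..m. i * f i)] (mod m)"
proof -
  interpret periodic_fun_simple f m by fact
  have "[(\<Sum>i=1..m. (c - i) * f (c - i)) = (\<Sum>i=1..m. ((c - i) mod m) * f (c - i))] (mod m)"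
    by (intro cong_sum cong_mult) (simp_all add: cong_def)
  also have "(\<Sum>i=1..m. ((c - i) mod m) * f (c - i)) = (\<Sum>i=1..m. (i mod m) * f i)"
    by (rule sum_periodic_reflect) (simp_all add: periodic_fun_simple_def plus_period \<open>m > 0\<close>)
  also have "[(\<Sum>i=1..m. (i mod m) * f i) = (\<Sum>i=1..m. i * f i)] (mod m)"
    by (intro cong_sum cong_mult) (simp_all add: cong_def)
  finally show ?thesis .
qed

section \<open>Dihedral groups\<close>

lemma (in group) generate_involution:
  assumes "\<sigma> \<in> carrier G" and "\<sigma> \<otimes> \<sigma> = \<one>"
  shows "generate G {\<sigma>} = {\<one>, \<sigma>}"
proof
  have "inv \<sigma> = \<sigma>" using assms by (simp add: inv_equality)
  then have "subgroup {\<one>, \<sigma>} G"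
    using assms by (intro subgroupI) auto
  then show "generate G {\<sigma>} \<subseteq> {\<one>, \<sigma>}"
    by (intro generate_subgroup_incl) auto
  show "{\<one>, \<sigma>} \<subseteq> generate G {\<sigma>}"
    by (auto intro: generate.intros)
qed

lemma (in group) generator_in_subgroup_generated:
  "g \<in> carrier G \<Longrightarrow> g \<in> carrier (subgroup_generated G {g})"
  by (simp add: carrier_subgroup_generated generate.incl)

lemma (in group) r_coset_generate_closed:
  assumes S_carrier: "S \<subseteq> carrier G" and \<C>_carrier: "\<C> \<subseteq> Pow (carrier G)"
    and closed: "\<And>K \<sigma>. K \<in> \<C> \<Longrightarrow> \<sigma> \<in> S \<Longrightarrow> K #> \<sigma> \<in> \<C> \<and> K #> inv \<sigma> \<in> \<C>"
    and "g \<in> generate G S" and "K \<in> \<C>"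
  shows "K #> g \<in> \<C>"
  using assms(4,5)
proof (induction arbitrary: K)
  case one
  then show ?case using \<C>_carrier by auto
next
  case (eng g h)
  then have "g \<in> carrier G" "h \<in> carrier G" "K \<subseteq> carrier G"
    using S_carrier \<C>_carrier generate_in_carrier by auto
  then show ?case
    using eng by (simp add: coset_mult_assoc[symmetric])
qed (simp_all add: closed)

lemma (in group) rcosets_rotations:
  assumes in_carrier: "\<sigma>\<^sub>1 \<in> carrier G" "\<sigma>\<^sub>2 \<in> carrier G"
    and involutions: "\<sigma>\<^sub>1 \<otimes> \<sigma>\<^sub>1 = \<one>" "\<sigma>\<^sub>2 \<otimes> \<sigma>\<^sub>2 = \<one>"
    and generates: "generate G {\<sigma>\<^sub>1, \<sigma>\<^sub>2} = carrier G"
  defines "H \<equiv> generate G {\<sigma>\<^sub>1 \<otimes> \<sigma>\<^sub>2}"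
  shows "rcosets H = {H, H #> \<sigma>\<^sub>1}"
proof
  have subgroup_H: "subgroup H G"
    using in_carrier unfolding H_def by (intro generate_is_subgroup) simp
  then have H_carrier: "H \<subseteq> carrier G"
    by (rule subgroup.subset)
  have inv_reflections: "inv \<sigma>\<^sub>1 = \<sigma>\<^sub>1" "inv \<sigma>\<^sub>2 = \<sigma>\<^sub>2"
    using in_carrier involutions by (simp_all add: inv_equality)
  have rotation_in: "\<sigma>\<^sub>1 \<otimes> \<sigma>\<^sub>2 \<in> H"
    unfolding H_def by (rule generate.incl) simp
  then have rotation_inv_in: "\<sigma>\<^sub>2 \<otimes> \<sigma>\<^sub>1 \<in> H"
    using subgroup.m_inv_closed[OF subgroup_H rotation_in] in_carrier
    by (simp add: inv_mult_group inv_reflections)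
  have "H #> \<sigma>\<^sub>1 #> \<sigma>\<^sub>1 = H" "H #> \<sigma>\<^sub>1 #> \<sigma>\<^sub>2 = H"
    using coset_join2[OF _ subgroup_H rotation_in] in_carrier involutions H_carrier
    by (simp_all add: coset_mult_assoc)
  moreover have "H #> \<sigma>\<^sub>2 = H #> \<sigma>\<^sub>1"
    using coset_join2[OF _ subgroup_H rotation_inv_in] in_carrier H_carrier
    by (intro coset_mult_inv1) (simp_all add: inv_reflections)
  ultimately have permute: "K #> \<sigma> \<in> {H, H #> \<sigma>\<^sub>1} \<and> K #> inv \<sigma> \<in> {H, H #> \<sigma>\<^sub>1}"
    if "K \<in> {H, H #> \<sigma>\<^sub>1}" "\<sigma> \<in> {\<sigma>\<^sub>1, \<sigma>\<^sub>2}" for K \<sigma>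
    using that by (auto simp: inv_reflections)
  have "H #> g \<in> {H, H #> \<sigma>\<^sub>1}" if "g \<in> carrier G" for g
    using that in_carrier H_carrier r_coset_subset_G
    by (intro r_coset_generate_closed[where S = "{\<sigma>\<^sub>1, \<sigma>\<^sub>2}"] permute) (auto simp: generates)
  then show "rcosets H \<subseteq> {H, H #> \<sigma>\<^sub>1}"
    by (auto simp: RCOSETS_def)
  show "{H, H #> \<sigma>\<^sub>1} \<subseteq> rcosets H"
    using subgroup.subgroup_in_rcosets[OF subgroup_H is_group]
      rcosetsI[OF H_carrier in_carrier(1)] by simp
qed

lemma (in group) reflection_notin_rotations:
  assumes in_carrier: "\<sigma>\<^sub>1 \<in> carrier G" "\<sigma>\<^sub>2 \<in> carrier G"
    and involutions: "\<sigma>\<^sub>1 \<otimes> \<sigma>\<^sub>1 = \<one>" "\<sigma>\<^sub>2 \<otimes> \<sigma>\<^sub>2 = \<one>"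
    and nontrivial: "\<sigma>\<^sub>1 \<noteq> \<one>" "\<sigma>\<^sub>2 \<noteq> \<one>"
  shows "\<sigma>\<^sub>1 \<notin> generate G {\<sigma>\<^sub>1 \<otimes> \<sigma>\<^sub>2}"
proof
  let ?\<rho> = "\<sigma>\<^sub>1 \<otimes> \<sigma>\<^sub>2"
  assume \<sigma>\<^sub>1_in: "\<sigma>\<^sub>1 \<in> generate G {?\<rho>}"
  then obtain k :: int where "\<sigma>\<^sub>1 = ?\<rho> [^] k"
    using in_carrier by (auto simp: generate_pow)
  then have "\<sigma>\<^sub>1 \<otimes> ?\<rho> = ?\<rho> \<otimes> \<sigma>\<^sub>1"
    using in_carrier int_pow_mult[of ?\<rho> k 1] int_pow_mult[of ?\<rho> 1 k] by (simp add: add.commute)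
  then have "\<sigma>\<^sub>2 = ?\<rho> \<otimes> \<sigma>\<^sub>1"
    using in_carrier involutions by (simp add: m_assoc[symmetric])
  then have "?\<rho> \<otimes> ?\<rho> = \<sigma>\<^sub>2 \<otimes> \<sigma>\<^sub>2"
    using in_carrier by (simp add: m_assoc[symmetric])
  then have "generate G {?\<rho>} = {\<one>, ?\<rho>}"
    using in_carrier involutions by (intro generate_involution) simp_all
  with \<sigma>\<^sub>1_in nontrivial(1) have "\<sigma>\<^sub>1 = ?\<rho>"
    by simp
  then show False
    using in_carrier nontrivial(2) by simp
qed

lemma order_rotation_subgroup:
  assumes "dihedral_group D n \<sigma>\<^sub>1 \<sigma>\<^sub>2"
  shows "order (subgroup_generated D {\<sigma>\<^sub>1 \<otimes>\<^bsub>D\<^esub> \<sigma>\<^sub>2}) = n"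
proof -
  interpret group D
    using assms by (simp add: dihedral_group_def)
  note dihedral = assms[unfolded dihedral_group_def]
  let ?H = "generate D {\<sigma>\<^sub>1 \<otimes>\<^bsub>D\<^esub> \<sigma>\<^sub>2}"
  have subgroup_H: "subgroup ?H D"
    using dihedral by (intro generate_is_subgroup) simp
  have "rcosets\<^bsub>D\<^esub> ?H = {?H, ?H #>\<^bsub>D\<^esub> \<sigma>\<^sub>1}"
    using dihedral by (intro rcosets_rotations) simp_all
  moreover have "\<sigma>\<^sub>1 \<notin> ?H"
    using dihedral by (intro reflection_notin_rotations) simp_all
  moreover have "\<sigma>\<^sub>1 \<in> ?H #>\<^bsub>D\<^esub> \<sigma>\<^sub>1"
    using dihedral subgroup_H by (intro rcos_self) simp_all
  ultimately have "card (rcosets\<^bsub>D\<^esub> ?H) = 2"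
    by (metis card_2_iff)
  with lagrange[OF subgroup_H] dihedral show ?thesis
    by (simp add: order_def carrier_subgroup_generated)
qed

section \<open>Pullbacks along quotient maps\<close>

lemma (in group_action) act_one: "x \<in> E \<Longrightarrow> \<phi> \<one> x = x"
  using id_eq_one by (metis restrict_apply')

lemma (in group_action) orbit_eq:
  assumes "x \<in> E" and "y \<in> orbit G \<phi> x"
  shows "orbit G \<phi> y = orbit G \<phi> x"
proof -
  have "y \<in> E"
    using assms element_image by (auto simp: orbit_def)
  then show ?thesis
    using disjoint_union[of "orbit G \<phi> y" "orbit G \<phi> x"] orbit_refl[of y] assms
    by (auto simp: orbits_def)
qed

lemma (in group_action) card_transporter:
  assumes "x \<in> E" and "y \<in> orbit G \<phi> x"
  shows "card {g \<in> carrier G. \<phi> g x = y} = card (stabilizer G \<phi> x)"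
proof -
  interpret group G
    using group_hom by (rule group_hom.axioms)
  from assms(2) obtain h where h_act: "h \<in> carrier G" "y = \<phi> h x"
    by (auto simp: orbit_def)
  have "bij_betw (\<lambda>g. h \<otimes> g) (stabilizer G \<phi> x) {g \<in> carrier G. \<phi> g x = y}"
  proof (rule bij_betw_byWitness[where f' = "\<lambda>g. inv h \<otimes> g"])
    show "(\<lambda>g. h \<otimes> g) ` stabilizer G \<phi> x \<subseteq> {g \<in> carrier G. \<phi> g x = y}"
      using assms(1) h_act by (auto simp: stabilizer_def composition_rule)
    show "(\<lambda>g. inv h \<otimes> g) ` {g \<in> carrier G. \<phi> g x = y} \<subseteq> stabilizer G \<phi> x"
      using assms(1) h_act orbit_sym_aux[of h x y] by (auto simp: stabilizer_def composition_rule)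
  qed (use h_act in \<open>auto simp: stabilizer_def m_assoc[symmetric]\<close>)
  then show ?thesis
    by (rule bij_betw_same_card[symmetric])
qed

lemma (in group_action) sum_act_eq_sum_orbit:
  fixes f :: "'c \<Rightarrow> 'd :: comm_semiring_1"
  assumes "finite (carrier G)" and "x \<in> E"
  shows "(\<Sum>g\<in>carrier G. f (\<phi> g x)) = of_nat (card (stabilizer G \<phi> x)) * (\<Sum>y\<in>orbit G \<phi> x. f y)"
proof -
  have "(\<Sum>g\<in>carrier G. f (\<phi> g x))
      = (\<Sum>y\<in>orbit G \<phi> x. \<Sum>g\<in>{g \<in> carrier G. \<phi> g x = y}. f (\<phi> g x))"
    using assms(1) by (intro sum.group[symmetric]) (auto simp: orbit_def)
  also have "\<dots> = (\<Sum>y\<in>orbit G \<phi> x. of_nat (card (stabilizer G \<phi> x)) * f y)"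
    using card_transporter[OF assms(2)] by (intro sum.cong) simp_all
  finally show ?thesis
    by (simp add: sum_distrib_left)
qed

abbreviation pullbacks ::
  "('g, 'm) monoid_scheme \<Rightarrow> ('v, 'e) multigraph \<Rightarrow> ('g \<Rightarrow> 'v \<Rightarrow> 'v) \<Rightarrow> ('v \<Rightarrow> int) set"
where
  "pullbacks \<Gamma> G \<phi> \<equiv> range (pullback \<Gamma> G \<phi>)"

lemma subspace_pullbacks: "int_fun.subspace (pullbacks \<Gamma> G \<phi>)"
proof (rule int_fun.subspaceI)
  have "0 = pullback \<Gamma> G \<phi> 0"
    by (auto simp: pullback_def)
  then show "0 \<in> pullbacks \<Gamma> G \<phi>"
    by blast
next
  fix f g assume "f \<in> pullbacks \<Gamma> G \<phi>" "g \<in> pullbacks \<Gamma> G \<phi>"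
  then obtain \<gamma> \<delta> where "f = pullback \<Gamma> G \<phi> \<gamma>" "g = pullback \<Gamma> G \<phi> \<delta>"
    by blast
  then have "f + g = pullback \<Gamma> G \<phi> (\<gamma> + \<delta>)"
    by (auto simp: pullback_def algebra_simps)
  then show "f + g \<in> pullbacks \<Gamma> G \<phi>"
    by blast
next
  fix c f assume "f \<in> pullbacks \<Gamma> G \<phi>"
  then obtain \<gamma> where "f = pullback \<Gamma> G \<phi> \<gamma>"
    by blast
  then have "c *\<^sub>z f = pullback \<Gamma> G \<phi> (c *\<^sub>z \<gamma>)"
    by (auto simp: pullback_def)
  then show "c *\<^sub>z f \<in> pullbacks \<Gamma> G \<phi>"
    by blast
qed

text \<open>
  Outside the vertex set \<open>\<phi> g\<close> takes the value \<open>undefined\<close>, so \<open>f \<circ> \<phi> g\<close> need not be a divisor.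
\<close>

definition translate ::
  "('v, 'e) multigraph \<Rightarrow> ('g \<Rightarrow> 'v \<Rightarrow> 'v) \<Rightarrow> 'g \<Rightarrow> ('v \<Rightarrow> int) \<Rightarrow> 'v \<Rightarrow> int"
where
  "translate G \<phi> g f = (\<lambda>v. if v \<in> verts G then f (\<phi> g v) else 0)"

lemma translate_in_divisors: "translate G \<phi> g f \<in> divisors G"
  by (simp add: translate_def divisors_def)

locale finite_vertex_action = group_action \<Gamma> "verts G" \<phi>
  for \<Gamma> :: "('g, 'm) monoid_scheme" and G :: "('v, 'e) multigraph" and \<phi> :: "'g \<Rightarrow> 'v \<Rightarrow> 'v" +
  assumes finite_group: "finite (carrier \<Gamma>)"
    and finite_verts: "finite (verts G)"
begin

sublocale group \<Gamma>
  using group_hom by (rule group_hom.axioms)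

lemma act_in_verts: "g \<in> carrier \<Gamma> \<Longrightarrow> v \<in> verts G \<Longrightarrow> \<phi> g v \<in> verts G"
  by (simp add: element_image)

lemma subgroup_generated_action:
  "finite_vertex_action (subgroup_generated \<Gamma> S) G \<phi>"
proof (intro finite_vertex_action.intro finite_vertex_action_axioms.intro)
  show "group_action (subgroup_generated \<Gamma> S) (verts G) \<phi>"
    unfolding subgroup_generated_def by (rule induced_action) (simp add: generate_is_subgroup)
  show "finite (carrier (subgroup_generated \<Gamma> S))"
    using finite_group carrier_subgroup_generated_subset finite_subset by blast
qed (rule finite_verts)

lemma order_pos: "order \<Gamma> > 0"
  using finite_group by (simp add: order_gt_0_iff_finite)

lemma card_stabilizer_pos: "v \<in> verts G \<Longrightarrow> card (stabilizer \<Gamma> \<phi> v) > 0"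
  using orbit_stabilizer_theorem[of v] order_pos by (metis gr0I mult_0_right less_irrefl)

lemma card_stabilizer_act:
  assumes "g \<in> carrier \<Gamma>" and "v \<in> verts G"
  shows "card (stabilizer \<Gamma> \<phi> (\<phi> g v)) = card (stabilizer \<Gamma> \<phi> v)"
proof -
  have "orbit \<Gamma> \<phi> (\<phi> g v) = orbit \<Gamma> \<phi> v"
    using assms by (intro orbit_eq) (auto simp: orbit_def)
  then show ?thesis
    using orbit_stabilizer_theorem[OF act_in_verts[OF assms]] orbit_stabilizer_theorem[OF assms(2)]
      order_pos by (metis mult_cancel1 mult_0 less_irrefl)
qed

lemma degree_pullback:
  "divisor_degree G (pullback \<Gamma> G \<phi> \<gamma>) = int (order \<Gamma>) * (\<Sum>B\<in>orbits \<Gamma> (verts G) \<phi>. \<gamma> B)"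
proof -
  have "(\<Sum>v\<in>B. pullback \<Gamma> G \<phi> \<gamma> v) = int (order \<Gamma>) * \<gamma> B"
    if B_orbit: "B \<in> orbits \<Gamma> (verts G) \<phi>" for B
  proof -
    from B_orbit obtain v where v_in: "v \<in> verts G" "B = orbit \<Gamma> \<phi> v"
      by (auto simp: orbits_def)
    have "pullback \<Gamma> G \<phi> \<gamma> w = int (card (stabilizer \<Gamma> \<phi> w)) * \<gamma> B" if "w \<in> B" for w
      using that v_in orbit_eq[OF v_in(1)] act_in_verts by (auto simp: pullback_def orbit_def)
    then have "(\<Sum>w\<in>B. pullback \<Gamma> G \<phi> \<gamma> w) = int (\<Sum>w\<in>B. card (stabilizer \<Gamma> \<phi> w)) * \<gamma> B"
      by (simp add: sum_distrib_right)
    then show ?thesis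
      using card_stablizer_sum[OF finite_group B_orbit] by simp
  qed
  then show ?thesis
    unfolding divisor_degree_def
    by (simp add: disjoint_sum[OF finite_verts, symmetric] sum_distrib_left)
qed

lemma order_dvd_degree_pullback:
  "f \<in> pullbacks \<Gamma> G \<phi> \<Longrightarrow> int (order \<Gamma>) dvd divisor_degree G f"
  by (auto simp: degree_pullback)

lemma pullbacks_deg0_eq:
  "pullbacks_deg0 \<Gamma> G \<phi> \<psi> = {f \<in> pullbacks \<Gamma> G \<phi>. divisor_degree G f = 0}"
proof
  have degree_quotient: "divisor_degree (quotient_graph \<Gamma> G \<phi> \<psi>) \<gamma>
      = (\<Sum>B\<in>orbits \<Gamma> (verts G) \<phi>. \<gamma> B)" for \<gamma>
    by (simp add: divisor_degree_def quotient_graph_def)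
  then show "pullbacks_deg0 \<Gamma> G \<phi> \<psi> \<subseteq> {f \<in> pullbacks \<Gamma> G \<phi>. divisor_degree G f = 0}"
    by (auto simp: pullbacks_deg0_def degree_pullback)
  show "{f \<in> pullbacks \<Gamma> G \<phi>. divisor_degree G f = 0} \<subseteq> pullbacks_deg0 \<Gamma> G \<phi> \<psi>"
  proof clarify
    fix \<gamma> assume degree: "divisor_degree G (pullback \<Gamma> G \<phi> \<gamma>) = 0"
    define \<gamma>' where "\<gamma>' B = (if B \<in> orbits \<Gamma> (verts G) \<phi> then \<gamma> B else 0)" for B
    have "pullback \<Gamma> G \<phi> \<gamma> = pullback \<Gamma> G \<phi> \<gamma>'"
      by (auto simp: pullback_def \<gamma>'_def orbits_def)
    moreover have "\<gamma>' \<in> divisors (quotient_graph \<Gamma> G \<phi> \<psi>)"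
      by (simp add: divisors_def quotient_graph_def \<gamma>'_def)
    moreover have "divisor_degree (quotient_graph \<Gamma> G \<phi> \<psi>) \<gamma>' = 0"
      using degree order_pos by (simp add: degree_quotient degree_pullback \<gamma>'_def)
    ultimately show "pullback \<Gamma> G \<phi> \<gamma> \<in> pullbacks_deg0 \<Gamma> G \<phi> \<psi>"
      unfolding pullbacks_deg0_def by blast
  qed
qed

lemma ex_pullback_degree_order:
  assumes "verts G \<noteq> {}"
  obtains u where "u \<in> pullbacks \<Gamma> G \<phi>" "divisor_degree G u = int (order \<Gamma>)"
proof -
  from assms obtain B where B_orbit: "B \<in> orbits \<Gamma> (verts G) \<phi>"
    by (auto simp: orbits_def)
  have "finite (orbits \<Gamma> (verts G) \<phi>)"
    using finite_verts by (simp add: orbits_def)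
  then have "(\<Sum>C\<in>orbits \<Gamma> (verts G) \<phi>. indicator {B} C) = (1 :: int)"
    using B_orbit by (simp add: indicator_def)
  then have "divisor_degree G (pullback \<Gamma> G \<phi> (indicator {B})) = int (order \<Gamma>)"
    by (simp only: degree_pullback mult_1_right)
  then show ?thesis
    using that by blast
qed

lemma pullbacksI:
  assumes divisor: "f \<in> divisors G"
    and invariant: "\<And>g v. g \<in> carrier \<Gamma> \<Longrightarrow> v \<in> verts G \<Longrightarrow> f (\<phi> g v) = f v"
    and dvd: "\<And>v. v \<in> verts G \<Longrightarrow> int (card (stabilizer \<Gamma> \<phi> v)) dvd f v"
  shows "f \<in> pullbacks \<Gamma> G \<phi>"
proof -
  \<comment> \<open>Dividing orbit sums by the group order avoids choosing a representative of each orbit.\<close>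
  have "f v = int (card (stabilizer \<Gamma> \<phi> v)) * ((\<Sum>w\<in>orbit \<Gamma> \<phi> v. f w) div int (order \<Gamma>))"
    if v_in: "v \<in> verts G" for v
  proof -
    let ?stab = "int (card (stabilizer \<Gamma> \<phi> v))"
    obtain c where f_v: "f v = ?stab * c"
      using dvd[OF v_in] by blast
    have "?stab * (\<Sum>w\<in>orbit \<Gamma> \<phi> v. f w) = (\<Sum>g\<in>carrier \<Gamma>. f (\<phi> g v))"
      by (simp add: sum_act_eq_sum_orbit[OF finite_group v_in])
    also have "\<dots> = ?stab * (int (order \<Gamma>) * c)"
      using invariant v_in by (simp add: order_def f_v)
    finally have "(\<Sum>w\<in>orbit \<Gamma> \<phi> v. f w) = int (order \<Gamma>) * c"
      using card_stabilizer_pos[OF v_in] by simp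
    then show ?thesis
      using order_pos by (simp add: f_v)
  qed
  then have "f = pullback \<Gamma> G \<phi> (\<lambda>B. (\<Sum>w\<in>B. f w) div int (order \<Gamma>))"
    using divisor by (auto simp: pullback_def divisors_def)
  then show ?thesis
    by (metis rangeI)
qed

lemma pullbacks_iff:
  "f \<in> pullbacks \<Gamma> G \<phi> \<longleftrightarrow> f \<in> divisors G \<and>
    (\<forall>g\<in>carrier \<Gamma>. \<forall>v\<in>verts G. f (\<phi> g v) = f v) \<and>
    (\<forall>v\<in>verts G. int (card (stabilizer \<Gamma> \<phi> v)) dvd f v)"
proof (intro iffI conjI ballI)
  assume "f \<in> pullbacks \<Gamma> G \<phi>"
  then obtain \<gamma> where f_eq: "f = pullback \<Gamma> G \<phi> \<gamma>"
    by blast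
  show "f \<in> divisors G"
    by (simp add: f_eq divisors_def pullback_def)
  fix v assume v_in: "v \<in> verts G"
  then show "int (card (stabilizer \<Gamma> \<phi> v)) dvd f v"
    by (simp add: f_eq pullback_def)
  fix g assume g_in: "g \<in> carrier \<Gamma>"
  have "orbit \<Gamma> \<phi> (\<phi> g v) = orbit \<Gamma> \<phi> v"
    using g_in v_in by (intro orbit_eq) (auto simp: orbit_def)
  then show "f (\<phi> g v) = f v"
    using g_in v_in by (simp add: f_eq pullback_def act_in_verts card_stabilizer_act)
qed (auto intro: pullbacksI)

lemma card_stabilizer_subgroup_generated_dvd:
  assumes v_in: "v \<in> verts G"
  shows "card (stabilizer (subgroup_generated \<Gamma> S) \<phi> v) dvd card (stabilizer \<Gamma> \<phi> v)"
proof -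
  let ?\<Delta> = "subgroup_generated \<Gamma> S"
  interpret \<Delta>: finite_vertex_action ?\<Delta> G \<phi>
    by (rule subgroup_generated_action)
  have "subgroup (stabilizer ?\<Delta> \<phi> v) \<Gamma>"
    using \<Delta>.stabilizer_subgroup[OF v_in] by (simp add: subgroup_subgroup_generated_iff)
  moreover have "stabilizer ?\<Delta> \<phi> v \<subseteq> stabilizer \<Gamma> \<phi> v"
    using carrier_subgroup_generated_subset by (auto simp: stabilizer_def)
  ultimately have "subgroup (stabilizer ?\<Delta> \<phi> v) (\<Gamma>\<lparr>carrier := stabilizer \<Gamma> \<phi> v\<rparr>)"
    by (rule subgroup_incl[OF _ stabilizer_subgroup[OF v_in]])
  from group.lagrange[OF subgroup_imp_group[OF stabilizer_subgroup[OF v_in]] this]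
  show ?thesis
    by (simp add: order_def) (metis dvd_triv_right)
qed

lemma pullbacks_subgroup_generated:
  "pullbacks \<Gamma> G \<phi> \<subseteq> pullbacks (subgroup_generated \<Gamma> S) G \<phi>"
proof
  let ?\<Delta> = "subgroup_generated \<Gamma> S"
  interpret \<Delta>: finite_vertex_action ?\<Delta> G \<phi>
    by (rule subgroup_generated_action)
  fix f assume "f \<in> pullbacks \<Gamma> G \<phi>"
  moreover have "int (card (stabilizer ?\<Delta> \<phi> v)) dvd f v"
    if "v \<in> verts G" "int (card (stabilizer \<Gamma> \<phi> v)) dvd f v" for v
    using card_stabilizer_subgroup_generated_dvd[OF that(1)] that(2) dvd_trans int_dvd_int_iff
    by blast
  ultimately show "f \<in> pullbacks ?\<Delta> G \<phi>"
    using carrier_subgroup_generated_subset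
    unfolding pullbacks_iff \<Delta>.pullbacks_iff by blast
qed

lemma sum_translates_in_pullbacks: "(\<Sum>g\<in>carrier \<Gamma>. translate G \<phi> g f) \<in> pullbacks \<Gamma> G \<phi>"
proof -
  have "(\<Sum>g\<in>carrier \<Gamma>. translate G \<phi> g f) = pullback \<Gamma> G \<phi> (\<lambda>B. \<Sum>w\<in>B. f w)"
    by (auto simp: sum_fun_apply translate_def pullback_def sum_act_eq_sum_orbit[OF finite_group])
  then show ?thesis
    by simp
qed

lemma translate_one: "f \<in> divisors G \<Longrightarrow> translate G \<phi> \<one>\<^bsub>\<Gamma>\<^esub> f = f"
  by (auto simp: translate_def divisors_def act_one)

lemma translate_mult:
  assumes "g \<in> carrier \<Gamma>" and "h \<in> carrier \<Gamma>"
  shows "translate G \<phi> (g \<otimes>\<^bsub>\<Gamma>\<^esub> h) f = translate G \<phi> h (translate G \<phi> g f)"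
  using assms by (auto simp: translate_def composition_rule act_in_verts)

lemma translate_indicator:
  assumes "g \<in> carrier \<Gamma>" and "v \<in> verts G"
  shows "translate G \<phi> g (indicator {\<phi> g v}) = indicator {v}"
  using assms inj_prop[OF assms(1)]
  by (auto simp: translate_def indicator_def fun_eq_iff dest: inj_onD)

lemma add_translate_in_pullbacks:
  assumes "\<sigma> \<in> carrier \<Gamma>" and "\<sigma> \<noteq> \<one>\<^bsub>\<Gamma>\<^esub>" and "\<sigma> \<otimes>\<^bsub>\<Gamma>\<^esub> \<sigma> = \<one>\<^bsub>\<Gamma>\<^esub>"
    and "f \<in> divisors G"
  shows "f + translate G \<phi> \<sigma> f \<in> pullbacks (subgroup_generated \<Gamma> {\<sigma>}) G \<phi>"
proof -
  interpret gen: finite_vertex_action "subgroup_generated \<Gamma> {\<sigma>}" G \<phi>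
    by (rule subgroup_generated_action)
  have "carrier (subgroup_generated \<Gamma> {\<sigma>}) = {\<one>\<^bsub>\<Gamma>\<^esub>, \<sigma>}"
    using assms by (simp add: carrier_subgroup_generated generate_involution)
  then have "(\<Sum>g\<in>carrier (subgroup_generated \<Gamma> {\<sigma>}). translate G \<phi> g f) = f + translate G \<phi> \<sigma> f"
    using assms by (simp add: translate_one)
  then show ?thesis
    using gen.sum_translates_in_pullbacks[of f] by simp
qed

lemma diff_translate_generate:
  assumes subspace_A: "int_fun.subspace A" and S_carrier: "S \<subseteq> carrier \<Gamma>"
    and generators: "\<And>g f. g \<in> S \<Longrightarrow> f \<in> divisors G \<Longrightarrow> f - translate G \<phi> g f \<in> A"
    and "g \<in> generate \<Gamma> S" and "f \<in> divisors G"
  shows "f - translate G \<phi> g f \<in> A"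
  using assms(4,5)
proof (induction arbitrary: f)
  case one
  then have "f - translate G \<phi> \<one>\<^bsub>\<Gamma>\<^esub> f = 0"
    by (simp only: translate_one diff_self)
  then show ?case
    using int_fun.subspace_0[OF subspace_A] by (simp only:)
next
  case (incl g)
  then show ?case by (rule generators)
next
  case (inv g)
  then have "translate G \<phi> g (translate G \<phi> (inv\<^bsub>\<Gamma>\<^esub> g) f) = f"
    using S_carrier by (simp add: translate_mult[symmetric] translate_one subset_iff)
  then have neg_eq: "f - translate G \<phi> (inv\<^bsub>\<Gamma>\<^esub> g) f
      = - (translate G \<phi> (inv\<^bsub>\<Gamma>\<^esub> g) f - translate G \<phi> g (translate G \<phi> (inv\<^bsub>\<Gamma>\<^esub> g) f))"
    by (simp only: minus_diff_eq)
  show ?case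
    unfolding neg_eq
    by (intro int_fun.subspace_neg[OF subspace_A] generators inv translate_in_divisors)
next
  case (eng g h)
  then have "g \<in> carrier \<Gamma>" "h \<in> carrier \<Gamma>"
    using generate_incl[OF S_carrier] by auto
  then have "f - translate G \<phi> (g \<otimes>\<^bsub>\<Gamma>\<^esub> h) f
      = (f - translate G \<phi> g f) + (translate G \<phi> g f - translate G \<phi> h (translate G \<phi> g f))"
    by (simp add: translate_mult)
  then show ?case
    using eng int_fun.subspace_add[OF subspace_A] translate_in_divisors by metis
qed

end

section \<open>Dihedral actions on strands\<close>

text \<open>
  A strand is a cyclically indexed family of \<open>n\<close> vertices. The strands \<open>x\<^sup>j\<close> and \<open>y\<^sup>j\<close> are
  swapped by the two reflections, whereas \<open>z\<^sup>j\<close> is swapped with itself.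
\<close>

locale dihedral_strands = finite_vertex_action D G \<phi>
  for D :: "('g, 'm) monoid_scheme" and G :: "('v, 'e) multigraph" and \<phi> :: "'g \<Rightarrow> 'v \<Rightarrow> 'v" +
  fixes n :: nat and \<sigma>\<^sub>1 \<sigma>\<^sub>2 :: 'g
    and I :: "'i set" and p :: "'i \<Rightarrow> int \<Rightarrow> 'v" and swap :: "'i \<Rightarrow> 'i"
  assumes odd_n: "odd n"
    and dihedral: "dihedral_group D n \<sigma>\<^sub>1 \<sigma>\<^sub>2"
    and verts_nonempty: "verts G \<noteq> {}"
    and swap_in: "a \<in> I \<Longrightarrow> swap a \<in> I"
    and swap_swap: "a \<in> I \<Longrightarrow> swap (swap a) = a"
    and periodic: "a \<in> I \<Longrightarrow> p a (i + int n) = p a i"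
    and \<sigma>\<^sub>1_strand: "a \<in> I \<Longrightarrow> \<phi> \<sigma>\<^sub>1 (p a i) = p (swap a) (1 - i)"
    and \<sigma>\<^sub>2_strand: "a \<in> I \<Longrightarrow> \<phi> \<sigma>\<^sub>2 (p a i) = p (swap a) (2 - i)"
    and bij_strands: "bij_betw (\<lambda>(a, i). p a i) (I \<times> {1..int n}) (verts G)"
begin

abbreviation "\<Gamma>\<^sub>1 \<equiv> subgroup_generated D {\<sigma>\<^sub>1}"
abbreviation "\<Gamma>\<^sub>2 \<equiv> subgroup_generated D {\<sigma>\<^sub>2}"
abbreviation "\<Gamma>\<^sub>3 \<equiv> subgroup_generated D {\<sigma>\<^sub>1 \<otimes>\<^bsub>D\<^esub> \<sigma>\<^sub>2}"

sublocale \<Gamma>\<^sub>1: finite_vertex_action \<Gamma>\<^sub>1 G \<phi>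
  by (rule subgroup_generated_action)

sublocale \<Gamma>\<^sub>2: finite_vertex_action \<Gamma>\<^sub>2 G \<phi>
  by (rule subgroup_generated_action)

sublocale \<Gamma>\<^sub>3: finite_vertex_action \<Gamma>\<^sub>3 G \<phi>
  by (rule subgroup_generated_action)

lemma n_pos: "n > 0"
  using odd_n by (rule odd_pos)

lemma reflections:
  "\<sigma>\<^sub>1 \<in> carrier D" "\<sigma>\<^sub>1 \<noteq> \<one>\<^bsub>D\<^esub>" "\<sigma>\<^sub>1 \<otimes>\<^bsub>D\<^esub> \<sigma>\<^sub>1 = \<one>\<^bsub>D\<^esub>"
  "\<sigma>\<^sub>2 \<in> carrier D" "\<sigma>\<^sub>2 \<noteq> \<one>\<^bsub>D\<^esub>" "\<sigma>\<^sub>2 \<otimes>\<^bsub>D\<^esub> \<sigma>\<^sub>2 = \<one>\<^bsub>D\<^esub>"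
  using dihedral by (auto simp: dihedral_group_def)

lemma order_generated_subgroups: "order \<Gamma>\<^sub>1 = 2" "order \<Gamma>\<^sub>2 = 2" "order \<Gamma>\<^sub>3 = n"
  using reflections order_rotation_subgroup[OF dihedral]
  by (simp_all add: order_def carrier_subgroup_generated generate_involution)

lemma strand_periodic: "a \<in> I \<Longrightarrow> periodic_fun_simple (\<lambda>i. f (p a i)) (int n)"
  by standard (simp add: periodic)

lemma strand_in_verts:
  assumes "a \<in> I"
  shows "p a i \<in> verts G"
proof -
  define k where "k = (i - 1) mod int n + 1"
  have "k \<in> {1..int n}"
    using n_pos by (simp add: k_def add1_zle_eq)
  moreover have "p a i = p a k"
    by (rule periodic_fun_cong[OF strand_periodic[OF assms, of "\<lambda>v. v"]])
      (simp add: k_def cong_def mod_simps)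
  ultimately show ?thesis
    using bij_betw_apply[OF bij_strands, of "(a, k)"] assms by simp
qed

lemma sum_verts: "(\<Sum>v\<in>verts G. F v) = (\<Sum>a\<in>I. \<Sum>i=1..int n. F (p a i))"
  using sum.reindex_bij_betw[OF bij_strands, of F]
  by (simp add: sum.cartesian_product case_prod_unfold)

lemma rotation_strand: "a \<in> I \<Longrightarrow> \<phi> (\<sigma>\<^sub>1 \<otimes>\<^bsub>D\<^esub> \<sigma>\<^sub>2) (p a i) = p a (i - 1)"
  using reflections
  by (simp add: composition_rule strand_in_verts \<sigma>\<^sub>1_strand \<sigma>\<^sub>2_strand swap_in swap_swap)

definition strand_sum :: "('v \<Rightarrow> int) \<Rightarrow> 'i \<Rightarrow> int"
  where "strand_sum f a = (\<Sum>i=1..int n. f (p a i))"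

definition weight :: "('v \<Rightarrow> int) \<Rightarrow> int"
  where "weight f = (\<Sum>a\<in>I. \<Sum>i=1..int n. i * f (p a i))"

lemma strand_sum_add: "strand_sum (f + g) a = strand_sum f a + strand_sum g a"
  by (simp add: strand_sum_def sum.distrib)

lemma strand_sum_diff: "strand_sum (f - g) a = strand_sum f a - strand_sum g a"
  by (simp add: strand_sum_def sum_subtractf)

lemma weight_add: "weight (f + g) = weight f + weight g"
  by (simp add: weight_def distrib_left sum.distrib)

lemma degree_eq_sum_strand_sum: "divisor_degree G f = (\<Sum>a\<in>I. strand_sum f a)"
  by (simp add: divisor_degree_def strand_sum_def sum_verts)

lemma strand_sum_reflect:
  assumes "b \<in> I" and "\<And>i. f (p b (c - i)) = g (p a i)"
  shows "strand_sum f b = strand_sum g a"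
  using sum_periodic_reflect[OF strand_periodic[OF assms(1)], of f c] n_pos
  by (simp add: assms(2) strand_sum_def)

lemma weight_reflect:
  assumes bij_\<tau>: "bij_betw \<tau> I I"
    and reflect: "\<And>a i. a \<in> I \<Longrightarrow> f (p (\<tau> a) (c - i)) = f (p a i)"
  shows "[2 * weight f = c * divisor_degree G f] (mod int n)"
proof -
  have \<tau>_in: "\<tau> a \<in> I" if "a \<in> I" for a
    using bij_betw_apply[OF bij_\<tau> that] .
  have "weight f = (\<Sum>a\<in>I. \<Sum>i=1..int n. i * f (p (\<tau> a) i))"
    unfolding weight_def by (rule sum.reindex_bij_betw[OF bij_\<tau>, symmetric])
  also have "[\<dots> = (\<Sum>a\<in>I. \<Sum>i=1..int n. (c - i) * f (p (\<tau> a) (c - i)))] (mod int n)"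
    by (intro cong_sum cong_sym[OF weighted_sum_periodic_reflect] strand_periodic \<tau>_in)
      (simp_all add: n_pos)
  also have "(\<Sum>a\<in>I. \<Sum>i=1..int n. (c - i) * f (p (\<tau> a) (c - i)))
      = (\<Sum>a\<in>I. \<Sum>i=1..int n. (c - i) * f (p a i))"
    by (intro sum.cong) (simp_all add: reflect)
  also have "\<dots> = c * divisor_degree G f - weight f"
    by (simp add: weight_def degree_eq_sum_strand_sum strand_sum_def sum_distrib_left
        left_diff_distrib sum_subtractf)
  finally show ?thesis
    by (simp add: cong_iff_dvd_diff algebra_simps)
qed

section \<open>Sums of pullbacks of arbitrary degree\<close>

abbreviation "\<A>\<^sub>1 \<equiv> pullbacks \<Gamma>\<^sub>1 G \<phi>"
abbreviation "\<A>\<^sub>2 \<equiv> pullbacks \<Gamma>\<^sub>2 G \<phi>"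
abbreviation "\<A>\<^sub>3 \<equiv> pullbacks \<Gamma>\<^sub>3 G \<phi>"
abbreviation "\<A> \<equiv> \<A>\<^sub>1 + \<A>\<^sub>2 + \<A>\<^sub>3"

lemma pullback\<^sub>1_strand: "f \<in> \<A>\<^sub>1 \<Longrightarrow> a \<in> I \<Longrightarrow> f (p (swap a) (1 - i)) = f (p a i)"
  using \<Gamma>\<^sub>1.pullbacks_iff generator_in_subgroup_generated reflections
  by (metis \<sigma>\<^sub>1_strand strand_in_verts)

lemma pullback\<^sub>2_strand: "f \<in> \<A>\<^sub>2 \<Longrightarrow> a \<in> I \<Longrightarrow> f (p (swap a) (2 - i)) = f (p a i)"
  using \<Gamma>\<^sub>2.pullbacks_iff generator_in_subgroup_generated reflections
  by (metis \<sigma>\<^sub>2_strand strand_in_verts)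

lemma pullback\<^sub>3_strand:
  assumes "f \<in> \<A>\<^sub>3" and "a \<in> I"
  shows "f (p a i) = f (p a k)"
proof -
  have "f (p a (i - 1)) = f (p a i)" for i
    using assms \<Gamma>\<^sub>3.pullbacks_iff generator_in_subgroup_generated reflections
    by (metis m_closed rotation_strand strand_in_verts)
  from this[of "_ + 1"] interpret periodic_fun_simple' "\<lambda>i. f (p a i)"
    by unfold_locales simp
  show ?thesis
    using of_int[of i] of_int[of k] by simp
qed

lemma bij_swap: "bij_betw swap I I"
  by (rule bij_betw_byWitness[where f' = swap]) (auto simp: swap_in swap_swap)

lemma weight_pullback\<^sub>1: "f \<in> \<A>\<^sub>1 \<Longrightarrow> [2 * weight f = divisor_degree G f] (mod int n)"
  using weight_reflect[OF bij_swap, of f 1] pullback\<^sub>1_strand by simp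

lemma weight_pullback\<^sub>2: "f \<in> \<A>\<^sub>2 \<Longrightarrow> [2 * weight f = 2 * divisor_degree G f] (mod int n)"
  using weight_reflect[OF bij_swap, of f 2] pullback\<^sub>2_strand by simp

lemma weight_pullback\<^sub>3:
  assumes "f \<in> \<A>\<^sub>3"
  shows "[2 * weight f = 0] (mod int n)"
  using weight_reflect[OF bij_betw_id, of f 0] pullback\<^sub>3_strand[OF assms] by simp

lemma strand_sum_pullback\<^sub>3:
  assumes "f \<in> \<A>\<^sub>3" and "a \<in> I"
  shows "int n dvd strand_sum f a"
proof -
  have "strand_sum f a = (\<Sum>i=1..int n. f (p a 0))"
    unfolding strand_sum_def by (intro sum.cong refl pullback\<^sub>3_strand[OF assms])
  then show ?thesis by simp
qed

definition balanced :: "('v \<Rightarrow> int) \<Rightarrow> bool"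
  where "balanced f \<longleftrightarrow> (\<forall>a\<in>I. [strand_sum f a = strand_sum f (swap a)] (mod int n))"

lemma pullback_sums_imp_balanced:
  assumes "f \<in> \<A>"
  shows "balanced f"
  unfolding balanced_def
proof
  fix a assume a_in: "a \<in> I"
  from assms obtain f\<^sub>1 f\<^sub>2 f\<^sub>3 where summands: "f = f\<^sub>1 + f\<^sub>2 + f\<^sub>3" "f\<^sub>1 \<in> \<A>\<^sub>1" "f\<^sub>2 \<in> \<A>\<^sub>2" "f\<^sub>3 \<in> \<A>\<^sub>3"
    by (elim set_plus_elim) blast
  have "strand_sum f\<^sub>1 (swap a) = strand_sum f\<^sub>1 a"
    using a_in summands
    by (intro strand_sum_reflect[where c = 1]) (simp_all add: swap_in pullback\<^sub>1_strand)
  moreover have "strand_sum f\<^sub>2 (swap a) = strand_sum f\<^sub>2 a"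
    using a_in summands
    by (intro strand_sum_reflect[where c = 2]) (simp_all add: swap_in pullback\<^sub>2_strand)
  moreover have "[strand_sum f\<^sub>3 a = strand_sum f\<^sub>3 (swap a)] (mod int n)"
    using strand_sum_pullback\<^sub>3[OF summands(4)] a_in swap_in by (simp add: cong_iff_dvd_diff)
  ultimately show "[strand_sum f a = strand_sum f (swap a)] (mod int n)"
    by (simp add: summands(1) strand_sum_add cong_add)
qed

lemma subspace_pullback_sums: "int_fun.subspace \<A>"
  by (intro int_fun.subspace_set_plus subspace_pullbacks)

lemmas pullback_sums_zero = int_fun.subspace_0[OF subspace_pullback_sums]
  and pullback_sums_add = int_fun.subspace_add[OF subspace_pullback_sums]
  and pullback_sums_diff = int_fun.subspace_diff[OF subspace_pullback_sums]
  and pullback_sums_scale = int_fun.subspace_scale[OF subspace_pullback_sums]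
  and pullback_sums_sum = int_fun.subspace_sum[OF subspace_pullback_sums]

lemma pullbacks_subset_pullback_sums:
  "\<A>\<^sub>1 \<subseteq> \<A>" "\<A>\<^sub>2 \<subseteq> \<A>" "\<A>\<^sub>3 \<subseteq> \<A>"
proof -
  have zero: "0 \<in> pullbacks \<Gamma> G \<phi>" for \<Gamma>
    by (rule int_fun.subspace_0[OF subspace_pullbacks])
  have "\<A>\<^sub>1 \<subseteq> \<A>\<^sub>2 + \<A>\<^sub>1" "\<A>\<^sub>2 \<subseteq> \<A>\<^sub>1 + \<A>\<^sub>2" "\<A>\<^sub>1 + \<A>\<^sub>2 \<subseteq> \<A>\<^sub>3 + (\<A>\<^sub>1 + \<A>\<^sub>2)"
    by (rule set_zero_plus2[OF zero])+
  then show "\<A>\<^sub>1 \<subseteq> \<A>" "\<A>\<^sub>2 \<subseteq> \<A>"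
    by (simp_all add: add.commute)
  show "\<A>\<^sub>3 \<subseteq> \<A>"
  proof (rule set_zero_plus2)
    show "0 \<in> \<A>\<^sub>1 + \<A>\<^sub>2"
      using set_plus_intro[OF zero zero] by (metis add_0)
  qed
qed

lemma diff_translate_rotation_in_pullback_sums:
  assumes "g \<in> carrier \<Gamma>\<^sub>3" and "f \<in> divisors G"
  shows "f - translate G \<phi> g f \<in> \<A>"
proof (rule diff_translate_generate[OF subspace_pullback_sums _ _ _ assms(2)])
  show "{\<sigma>\<^sub>1 \<otimes>\<^bsub>D\<^esub> \<sigma>\<^sub>2} \<subseteq> carrier D"
    using reflections by simp
  then show "g \<in> generate D {\<sigma>\<^sub>1 \<otimes>\<^bsub>D\<^esub> \<sigma>\<^sub>2}"
    using assms(1) by (simp add: carrier_subgroup_generated)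
  fix f \<rho> assume "\<rho> \<in> {\<sigma>\<^sub>1 \<otimes>\<^bsub>D\<^esub> \<sigma>\<^sub>2}" and f_in: "f \<in> divisors G"
  then have "f - translate G \<phi> \<rho> f = (f + translate G \<phi> \<sigma>\<^sub>1 f)
      - (translate G \<phi> \<sigma>\<^sub>1 f + translate G \<phi> \<sigma>\<^sub>2 (translate G \<phi> \<sigma>\<^sub>1 f))"
    using reflections by (simp add: translate_mult)
  also have "\<dots> \<in> \<A>"
    by (intro pullback_sums_diff pullbacks_subset_pullback_sums[THEN subsetD]
        add_translate_in_pullbacks reflections f_in translate_in_divisors)
  finally show "f - translate G \<phi> \<rho> f \<in> \<A>" .
qed

lemma n_scale_in_pullback_sums:
  assumes "f \<in> divisors G"
  shows "int n *\<^sub>z f \<in> \<A>"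
proof -
  have "int n *\<^sub>z f = (\<Sum>g\<in>carrier \<Gamma>\<^sub>3. f - translate G \<phi> g f)
      + (\<Sum>g\<in>carrier \<Gamma>\<^sub>3. translate G \<phi> g f)"
    using order_generated_subgroups(3) by (auto simp: sum_fun_apply sum_subtractf order_def)
  also have "\<dots> \<in> \<A>"
    by (intro pullback_sums_add pullback_sums_sum diff_translate_rotation_in_pullback_sums assms
        \<Gamma>\<^sub>3.sum_translates_in_pullbacks pullbacks_subset_pullback_sums(3)[THEN subsetD])
  finally show ?thesis .
qed

lemma indicator_diff_in_pullback_sums:
  assumes "a \<in> I" and "k \<le> i"
  shows "indicator {p a i} - indicator {p a k} \<in> \<A>"
  using assms(2)
proof (induction i rule: int_ge_induct)
  case base
  then show ?case
    using pullback_sums_zero by (simp only: diff_self)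
next
  case (step i)
  let ?\<rho> = "\<sigma>\<^sub>1 \<otimes>\<^bsub>D\<^esub> \<sigma>\<^sub>2"
  have "translate G \<phi> ?\<rho> (indicator {p a i}) = indicator {p a (i + 1)}"
    using translate_indicator[of ?\<rho> "p a (i + 1)"] assms(1) reflections
    by (simp add: rotation_strand strand_in_verts)
  then have rotate: "indicator {p a i} - indicator {p a (i + 1)} \<in> \<A>"
    using diff_translate_rotation_in_pullback_sums[of ?\<rho> "indicator {p a i}"] assms(1) reflections
    by (simp only: generator_in_subgroup_generated m_closed indicator_in_divisors strand_in_verts)
  have "indicator {p a (i + 1)} - indicator {p a k} = (indicator {p a i} - indicator {p a k})
      - (indicator {p a i} - (indicator {p a (i + 1)} :: 'v \<Rightarrow> int))"
    by simp
  also have "\<dots> \<in> \<A>"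
    by (rule pullback_sums_diff[OF step.IH rotate])
  finally show ?case .
qed

lemma strand_sums_dvd_imp_in_pullback_sums:
  assumes divisor: "f \<in> divisors G" and dvd: "\<And>a. a \<in> I \<Longrightarrow> int n dvd strand_sum f a"
  shows "f \<in> \<A>"
proof -
  have strand_in: "(\<Sum>i=1..int n. f (p a i) *\<^sub>z indicator {p a i}) \<in> \<A>" if a_in: "a \<in> I" for a
  proof -
    obtain m where strand_sum_eq: "strand_sum f a = m * int n"
      using dvd[OF a_in] by (auto simp: dvd_def mult.commute)
    have "(\<Sum>i=1..int n. f (p a i) *\<^sub>z indicator {p a i})
        = (\<Sum>i=1..int n. f (p a i) *\<^sub>z (indicator {p a i} - indicator {p a 1}))
          + m *\<^sub>z int n *\<^sub>z indicator {p a 1}" (is "?L = ?R")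
    proof
      fix w
      have "?R w = ?L w - strand_sum f a * indicator {p a 1} w + m * (int n * indicator {p a 1} w)"
        by (simp add: sum_fun_apply right_diff_distrib sum_subtractf strand_sum_def
            sum_distrib_right)
      then show "?L w = ?R w"
        by (simp add: strand_sum_eq)
    qed
    also have "\<dots> \<in> \<A>"
      using a_in
      by (intro pullback_sums_add pullback_sums_scale pullback_sums_sum n_scale_in_pullback_sums
          indicator_diff_in_pullback_sums indicator_in_divisors strand_in_verts) simp_all
    finally show ?thesis .
  qed
  have "f = (\<Sum>a\<in>I. \<Sum>i=1..int n. f (p a i) *\<^sub>z indicator {p a i})"
    using divisor_eq_sum_indicators[OF finite_verts divisor] unfolding sum_verts .
  also have "\<dots> \<in> \<A>"
    by (intro pullback_sums_sum strand_in)
  finally show ?thesis .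
qed

lemma balanced_imp_in_pullback_sums:
  assumes divisor: "f \<in> divisors G" and "balanced f"
  shows "f \<in> \<A>"
proof -
  let ?f\<sigma> = "translate G \<phi> \<sigma>\<^sub>1 f"
  have "strand_sum ?f\<sigma> a = strand_sum f (swap a)" if "a \<in> I" for a
    using that by (intro strand_sum_reflect[of _ _ 1, symmetric])
      (simp_all add: swap_in translate_def strand_in_verts \<sigma>\<^sub>1_strand)
  then have "int n dvd strand_sum (f - ?f\<sigma>) a" if "a \<in> I" for a
    using that \<open>balanced f\<close> by (simp add: balanced_def strand_sum_diff cong_iff_dvd_diff)
  moreover have "f - ?f\<sigma> \<in> divisors G"
    using divisor translate_in_divisors by (simp add: divisors_def)
  ultimately have diff_in: "f - ?f\<sigma> \<in> \<A>"
    by (intro strand_sums_dvd_imp_in_pullback_sums)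
  have add_in: "f + ?f\<sigma> \<in> \<A>"
    using add_translate_in_pullbacks[OF reflections(1-3) divisor]
      pullbacks_subset_pullback_sums(1) by blast
  obtain m where "n = 2 * m + 1"
    using odd_n by (rule oddE)
  then have "f = int n *\<^sub>z f - int m *\<^sub>z ((f + ?f\<sigma>) + (f - ?f\<sigma>))"
    by (auto simp: algebra_simps)
  also have "\<dots> \<in> \<A>"
    by (intro pullback_sums_diff[OF n_scale_in_pullback_sums[OF divisor]]
        pullback_sums_scale pullback_sums_add[OF add_in diff_in])
  finally show ?thesis .
qed

section \<open>Sums of pullbacks of degree zero\<close>

lemma pullback_sum_eq:
  "pullback_sum D \<sigma>\<^sub>1 \<sigma>\<^sub>2 G \<phi> \<psi> = {f \<in> \<A>\<^sub>1. divisor_degree G f = 0}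
     + {f \<in> \<A>\<^sub>2. divisor_degree G f = 0} + {f \<in> \<A>\<^sub>3. divisor_degree G f = 0}"
proof -
  have sum_eq: "(\<lambda>v. f\<^sub>1 v + f\<^sub>2 v + f\<^sub>3 v) = f\<^sub>1 + f\<^sub>2 + f\<^sub>3" for f\<^sub>1 f\<^sub>2 f\<^sub>3 :: "'v \<Rightarrow> int"
    by (simp add: plus_fun_def)
  show ?thesis
    unfolding pullback_sum_def \<Gamma>\<^sub>1.pullbacks_deg0_eq \<Gamma>\<^sub>2.pullbacks_deg0_eq \<Gamma>\<^sub>3.pullbacks_deg0_eq
      sum_eq set_plus_def by blast
qed

lemma weight_sum_pullbacks:
  assumes "f\<^sub>1 \<in> \<A>\<^sub>1" and "f\<^sub>2 \<in> \<A>\<^sub>2" and "f\<^sub>3 \<in> \<A>\<^sub>3"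
  shows "[2 * weight (f\<^sub>1 + f\<^sub>2 + f\<^sub>3) = divisor_degree G f\<^sub>1 + 2 * divisor_degree G f\<^sub>2] (mod int n)"
  using cong_add[OF cong_add[OF weight_pullback\<^sub>1[OF assms(1)] weight_pullback\<^sub>2[OF assms(2)]]
      weight_pullback\<^sub>3[OF assms(3)]]
  by (simp add: weight_add distrib_left)

lemma weight_cong_0_iff: "[weight f = 0] (mod int n) \<longleftrightarrow> [2 * weight f = 0] (mod int n)"
  using odd_n cong_mult_lcancel[of 2 "int n" "weight f" 0] by (simp add: coprime_commute)

lemma summand_degrees_dvd:
  assumes summands: "f\<^sub>1 \<in> \<A>\<^sub>1" "f\<^sub>2 \<in> \<A>\<^sub>2" "f\<^sub>3 \<in> \<A>\<^sub>3"
    and degree: "divisor_degree G (f\<^sub>1 + f\<^sub>2 + f\<^sub>3) = 0"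
    and weight: "[weight (f\<^sub>1 + f\<^sub>2 + f\<^sub>3) = 0] (mod int n)"
  shows "int (2 * n) dvd divisor_degree G f\<^sub>1" "int (2 * n) dvd divisor_degree G f\<^sub>2"
    "int (2 * n) dvd divisor_degree G f\<^sub>3"
proof -
  let ?d = "divisor_degree G"
  have degree_sum: "?d f\<^sub>1 + ?d f\<^sub>2 + ?d f\<^sub>3 = 0"
    using degree by (simp only: divisor_degree_add)
  have n_dvd: "int n dvd ?d f\<^sub>1 + 2 * ?d f\<^sub>2"
    using weight weight_sum_pullbacks[OF summands] unfolding weight_cong_0_iff
    by (metis cong_0_iff cong_sym cong_trans)
  have even: "even (?d f\<^sub>1)" "even (?d f\<^sub>2)" and n_dvd\<^sub>3: "int n dvd ?d f\<^sub>3"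
    using \<Gamma>\<^sub>1.order_dvd_degree_pullback[OF summands(1)] \<Gamma>\<^sub>2.order_dvd_degree_pullback[OF summands(2)]
      \<Gamma>\<^sub>3.order_dvd_degree_pullback[OF summands(3)]
    by (simp_all add: order_generated_subgroups)
  have "?d f\<^sub>2 = (?d f\<^sub>1 + 2 * ?d f\<^sub>2) + ?d f\<^sub>3"
    using degree_sum by simp
  then have n_dvd\<^sub>2: "int n dvd ?d f\<^sub>2"
    using n_dvd n_dvd\<^sub>3 by (metis dvd_add)
  have n_dvd\<^sub>1: "int n dvd ?d f\<^sub>1"
    using n_dvd n_dvd\<^sub>2 by (simp add: dvd_add_left_iff)
  have even\<^sub>3: "even (?d f\<^sub>3)"
    using even degree_sum by presburger
  have "int (2 * n) dvd d" if "even d" "int n dvd d" for d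
    using divides_mult[OF that] odd_n by simp
  then show "int (2 * n) dvd ?d f\<^sub>1" "int (2 * n) dvd ?d f\<^sub>2" "int (2 * n) dvd ?d f\<^sub>3"
    using even even\<^sub>3 n_dvd\<^sub>1 n_dvd\<^sub>2 n_dvd\<^sub>3 by blast+
qed

lemma summand_degrees_dvd_imp_in_pullback_sum:
  assumes summands: "f\<^sub>1 \<in> \<A>\<^sub>1" "f\<^sub>2 \<in> \<A>\<^sub>2" "f\<^sub>3 \<in> \<A>\<^sub>3"
    and degree: "divisor_degree G (f\<^sub>1 + f\<^sub>2 + f\<^sub>3) = 0"
    and dvd: "int (2 * n) dvd divisor_degree G f\<^sub>1" "int (2 * n) dvd divisor_degree G f\<^sub>2"
      "int (2 * n) dvd divisor_degree G f\<^sub>3"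
  shows "f\<^sub>1 + f\<^sub>2 + f\<^sub>3 \<in> pullback_sum D \<sigma>\<^sub>1 \<sigma>\<^sub>2 G \<phi> \<psi>"
proof -
  from dvd obtain c\<^sub>1 c\<^sub>2 c\<^sub>3 where degree_eq: "divisor_degree G f\<^sub>1 = c\<^sub>1 * int (2 * n)"
      "divisor_degree G f\<^sub>2 = c\<^sub>2 * int (2 * n)" "divisor_degree G f\<^sub>3 = c\<^sub>3 * int (2 * n)"
    by (metis dvd_def mult.commute)
  have "(c\<^sub>1 + c\<^sub>2 + c\<^sub>3) * int (2 * n) = 0"
    using degree by (simp only: divisor_degree_add degree_eq distrib_right)
  then have c_sum: "c\<^sub>1 + c\<^sub>2 + c\<^sub>3 = 0"
    using n_pos by simp
  obtain u where u_pullback: "u \<in> pullbacks D G \<phi>" "divisor_degree G u = int (2 * n)"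
    using ex_pullback_degree_order[OF verts_nonempty] dihedral by (metis dihedral_group_def)
  have u_in: "u \<in> pullbacks (subgroup_generated D S) G \<phi>" for S
    using u_pullback(1) pullbacks_subgroup_generated by blast
  have shift: "f - c *\<^sub>z u \<in> {f \<in> pullbacks (subgroup_generated D S) G \<phi>. divisor_degree G f = 0}"
    if "f \<in> pullbacks (subgroup_generated D S) G \<phi>" "divisor_degree G f = c * int (2 * n)"
    for f c S
    using int_fun.subspace_diff[OF subspace_pullbacks that(1)
        int_fun.subspace_scale[OF subspace_pullbacks u_in]] that(2)
    by (simp add: divisor_degree_diff_scale u_pullback(2))
  have "f\<^sub>1 + f\<^sub>2 + f\<^sub>3 = f\<^sub>1 + f\<^sub>2 + f\<^sub>3 - (c\<^sub>1 + c\<^sub>2 + c\<^sub>3) *\<^sub>z u"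
    by (simp only: c_sum int_fun.scale_zero_left diff_zero)
  also have "\<dots> = (f\<^sub>1 - c\<^sub>1 *\<^sub>z u) + (f\<^sub>2 - c\<^sub>2 *\<^sub>z u) + (f\<^sub>3 - c\<^sub>3 *\<^sub>z u)"
    by (simp add: int_fun.scale_left_distrib)
  also have "\<dots> \<in> pullback_sum D \<sigma>\<^sub>1 \<sigma>\<^sub>2 G \<phi> \<psi>"
    unfolding pullback_sum_eq by (intro set_plus_intro shift summands degree_eq)
  finally show ?thesis .
qed

lemma in_pullback_sum_iff_weight:
  assumes "f \<in> \<A>" and degree: "divisor_degree G f = 0"
  shows "f \<in> pullback_sum D \<sigma>\<^sub>1 \<sigma>\<^sub>2 G \<phi> \<psi> \<longleftrightarrow> [weight f = 0] (mod int n)"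
proof
  assume "f \<in> pullback_sum D \<sigma>\<^sub>1 \<sigma>\<^sub>2 G \<phi> \<psi>"
  then obtain f\<^sub>1 f\<^sub>2 f\<^sub>3 where "f = f\<^sub>1 + f\<^sub>2 + f\<^sub>3" "f\<^sub>1 \<in> \<A>\<^sub>1" "f\<^sub>2 \<in> \<A>\<^sub>2" "f\<^sub>3 \<in> \<A>\<^sub>3"
    "divisor_degree G f\<^sub>1 = 0" "divisor_degree G f\<^sub>2 = 0"
    unfolding pullback_sum_eq by (elim set_plus_elim) blast
  then show "[weight f = 0] (mod int n)"
    using weight_sum_pullbacks[of f\<^sub>1 f\<^sub>2 f\<^sub>3] by (simp add: weight_cong_0_iff)
next
  assume weight: "[weight f = 0] (mod int n)"
  from assms(1) obtain f\<^sub>1 f\<^sub>2 f\<^sub>3 where f_eq: "f = f\<^sub>1 + f\<^sub>2 + f\<^sub>3" and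
    summands: "f\<^sub>1 \<in> \<A>\<^sub>1" "f\<^sub>2 \<in> \<A>\<^sub>2" "f\<^sub>3 \<in> \<A>\<^sub>3"
    by (elim set_plus_elim) blast
  show "f \<in> pullback_sum D \<sigma>\<^sub>1 \<sigma>\<^sub>2 G \<phi> \<psi>"
    unfolding f_eq
    by (intro summand_degrees_dvd_imp_in_pullback_sum summands degree[unfolded f_eq]
        summand_degrees_dvd[OF summands degree[unfolded f_eq] weight[unfolded f_eq]])
qed

theorem in_pullback_sum_iff:
  assumes "f \<in> divisors G" and "divisor_degree G f = 0"
  shows "f \<in> pullback_sum D \<sigma>\<^sub>1 \<sigma>\<^sub>2 G \<phi> \<psi> \<longleftrightarrow> [weight f = 0] (mod int n) \<and> balanced f"
proof -
  have "pullback_sum D \<sigma>\<^sub>1 \<sigma>\<^sub>2 G \<phi> \<psi> \<subseteq> \<A>"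
    unfolding pullback_sum_eq by (intro set_plus_mono2) auto
  then show ?thesis
    using assms pullback_sums_imp_balanced balanced_imp_in_pullback_sums in_pullback_sum_iff_weight
    by blast
qed

end

section \<open>The labelling\<close>

datatype strand = Strand_x nat | Strand_y nat | Strand_z nat

primrec swap_strand :: "strand \<Rightarrow> strand" where
  "swap_strand (Strand_x j) = Strand_y j"
| "swap_strand (Strand_y j) = Strand_x j"
| "swap_strand (Strand_z j) = Strand_z j"

primrec strand_vertex ::
  "(int \<Rightarrow> nat \<Rightarrow> 'v) \<Rightarrow> (int \<Rightarrow> nat \<Rightarrow> 'v) \<Rightarrow> (int \<Rightarrow> nat \<Rightarrow> 'v) \<Rightarrow> strand \<Rightarrow> int \<Rightarrow> 'v"
where
  "strand_vertex z x y (Strand_x j) = (\<lambda>i. x i j)"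
| "strand_vertex z x y (Strand_y j) = (\<lambda>i. y i j)"
| "strand_vertex z x y (Strand_z j) = (\<lambda>i. z i j)"

definition strands :: "nat \<Rightarrow> nat \<Rightarrow> strand set"
  where "strands s t = Strand_x ` {1..t} \<union> Strand_y ` {1..t} \<union> Strand_z ` {1..s}"

lemma sum_strands:
  fixes F :: "strand \<Rightarrow> 'a :: comm_monoid_add"
  shows "(\<Sum>a\<in>strands s t. F a)
    = (\<Sum>j=1..t. F (Strand_x j)) + (\<Sum>j=1..t. F (Strand_y j)) + (\<Sum>j=1..s. F (Strand_z j))"
proof -
  have "(\<Sum>a\<in>strands s t. F a) = (\<Sum>a\<in>Strand_x ` {1..t}. F a) + (\<Sum>a\<in>Strand_y ` {1..t}. F a)
      + (\<Sum>a\<in>Strand_z ` {1..s}. F a)"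
    unfolding strands_def by (subst sum.union_disjoint; auto)+
  then show ?thesis
    by (simp add: sum.reindex inj_on_def)
qed

lemma card_strands: "card (strands s t) = s + 2 * t"
  using sum_strands[of "\<lambda>_. 1 :: nat" s t] by simp

lemma image_strand_vertex:
  assumes action: "group_action D (verts G) \<phi>"
    and sizes: "\<forall>B\<in>orbits D (verts G) \<phi>. card B = n \<or> card B = 2 * n"
    and labelling: "dihedral_labelling D n \<sigma>\<^sub>1 \<sigma>\<^sub>2 G \<phi> s t z x y"
  shows "(\<lambda>(a, i). strand_vertex z x y a i) ` (strands s t \<times> {1..int n}) = verts G"
proof -
  let ?orbits = "orbits D (verts G) \<phi>"
  have labels: "(\<lambda>j. {z i j | i. i \<in> {1..int n}}) ` {1..s} = {B \<in> ?orbits. card B = n}"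
    "(\<lambda>j. {x i j | i. i \<in> {1..int n}} \<union> {y i j | i. i \<in> {1..int n}}) ` {1..t}
      = {B \<in> ?orbits. card B = 2 * n}"
    using labelling by (simp_all add: dihedral_labelling_def bij_betw_def)
  have "(\<lambda>(a, i). strand_vertex z x y a i) ` (strands s t \<times> {1..int n})
      = (\<Union>a\<in>strands s t. strand_vertex z x y a ` {1..int n})"
    by auto
  also have "\<dots> = (\<Union>j\<in>{1..s}. {z i j | i. i \<in> {1..int n}})
      \<union> (\<Union>j\<in>{1..t}. {x i j | i. i \<in> {1..int n}} \<union> {y i j | i. i \<in> {1..int n}})"
    unfolding strands_def Setcompr_eq_image by (simp add: UN_Un UN_Un_distrib Un_ac)
  also have "\<dots> = \<Union> ?orbits"
    using sizes unfolding labels by blast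
  finally show ?thesis
    by (simp add: group_action.orbits_coverture[OF action])
qed

lemma card_verts_labelling:
  assumes action: "group_action D (verts G) \<phi>" and "finite (verts G)" and "n > 0"
    and sizes: "\<forall>B\<in>orbits D (verts G) \<phi>. card B = n \<or> card B = 2 * n"
    and labelling: "dihedral_labelling D n \<sigma>\<^sub>1 \<sigma>\<^sub>2 G \<phi> s t z x y"
  shows "card (verts G) = s * n + t * (2 * n)"
proof -
  let ?orbits = "orbits D (verts G) \<phi>"
  let ?small = "{B \<in> ?orbits. card B = n}" and ?large = "{B \<in> ?orbits. card B = 2 * n}"
  have cards: "card ?small = s" "card ?large = t"
    using labelling by (auto simp: dihedral_labelling_def dest!: bij_betw_same_card)
  have "card (verts G) = (\<Sum>B\<in>?orbits. card B)"
    using group_action.disjoint_sum[OF action \<open>finite (verts G)\<close>, of "\<lambda>_. 1 :: nat"] by simp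
  also have "?orbits = ?small \<union> ?large"
    using sizes by blast
  also have "(\<Sum>B\<in>?small \<union> ?large. card B) = (\<Sum>B\<in>?small. card B) + (\<Sum>B\<in>?large. card B)"
    using \<open>finite (verts G)\<close> \<open>n > 0\<close> by (intro sum.union_disjoint) (auto simp: orbits_def)
  finally show ?thesis
    by (simp add: cards)
qed

lemma bij_betw_strand_vertex:
  assumes "group_action D (verts G) \<phi>" and "finite (verts G)" and "n > 0"
    and "\<forall>B\<in>orbits D (verts G) \<phi>. card B = n \<or> card B = 2 * n"
    and "dihedral_labelling D n \<sigma>\<^sub>1 \<sigma>\<^sub>2 G \<phi> s t z x y"
  shows "bij_betw (\<lambda>(a, i). strand_vertex z x y a i) (strands s t \<times> {1..int n}) (verts G)"
proof -
  note image = image_strand_vertex[OF assms(1,4,5)]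
  have "card (verts G) = card (strands s t \<times> {1..int n})"
    using card_verts_labelling[OF assms]
    by (simp add: card_cartesian_product card_strands algebra_simps)
  then have "inj_on (\<lambda>(a, i). strand_vertex z x y a i) (strands s t \<times> {1..int n})"
    using image by (intro eq_card_imp_inj_on) (simp_all add: strands_def)
  with image show ?thesis
    by (simp add: bij_betw_def)
qed

lemma dihedral_labelling_imp_dihedral_strands:
  assumes odd_n: "odd n" and dihedral: "dihedral_group D n \<sigma>\<^sub>1 \<sigma>\<^sub>2"
    and action: "group_action D (verts G) \<phi>" and verts: "finite (verts G)" "verts G \<noteq> {}"
    and sizes: "\<forall>B\<in>orbits D (verts G) \<phi>. card B = n \<or> card B = 2 * n"
    and labelling: "dihedral_labelling D n \<sigma>\<^sub>1 \<sigma>\<^sub>2 G \<phi> s t z x y"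
  shows "dihedral_strands D G \<phi> n \<sigma>\<^sub>1 \<sigma>\<^sub>2 (strands s t) (strand_vertex z x y) swap_strand"
proof (intro dihedral_strands.intro finite_vertex_action.intro finite_vertex_action_axioms.intro
    dihedral_strands_axioms.intro)
  have "n > 0"
    using odd_n by (rule odd_pos)
  then show "finite (carrier D)"
    using dihedral by (auto simp: dihedral_group_def order_def intro: card_ge_0_finite)
  show "bij_betw (\<lambda>(a, i). strand_vertex z x y a i) (strands s t \<times> {1..int n}) (verts G)"
    by (rule bij_betw_strand_vertex[OF action verts(1) \<open>n > 0\<close> sizes labelling])
next
  let ?p = "strand_vertex z x y"
  fix a i assume a_in: "a \<in> strands s t"
  then show swap: "swap_strand a \<in> strands s t" "swap_strand (swap_strand a) = a"
    by (auto simp: strands_def)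
  have periodic: "?p b (k + int n) = ?p b k" if "b \<in> strands s t" for b k
    using that labelling by (auto simp: strands_def dihedral_labelling_def)
  then show "?p a (i + int n) = ?p a i"
    using a_in .
  have "\<phi> \<sigma>\<^sub>1 (?p a i) = ?p (swap_strand a) (int n + 1 - i)"
    "\<phi> \<sigma>\<^sub>2 (?p a i) = ?p (swap_strand a) (int n + 2 - i)"
    using a_in labelling by (auto simp: strands_def dihedral_labelling_def)
  then show "\<phi> \<sigma>\<^sub>1 (?p a i) = ?p (swap_strand a) (1 - i)"
    "\<phi> \<sigma>\<^sub>2 (?p a i) = ?p (swap_strand a) (2 - i)"
    using periodic[OF swap(1), of "1 - i"] periodic[OF swap(1), of "2 - i"]
    by (simp_all add: algebra_simps)
qed (use assms in simp_all)

theorem theorem3p3: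
  fixes D :: "('g, 'm) monoid_scheme" and n :: nat and \<sigma>\<^sub>1 \<sigma>\<^sub>2 :: 'g
    and G :: "('v, 'e) multigraph"
    and \<phi> :: "'g \<Rightarrow> 'v \<Rightarrow> 'v" and \<psi> :: "'g \<Rightarrow> 'e \<Rightarrow> 'e"
    and s t :: nat and z x y :: "int \<Rightarrow> nat \<Rightarrow> 'v"
    and \<delta> :: "'v \<Rightarrow> int"
  assumes "odd n"
    and "dihedral_group D n \<sigma>\<^sub>1 \<sigma>\<^sub>2"
    and "finite_loopless_graph G" and "connected_graph G"
    and "harmonic_action D G \<phi> \<psi>"
    and "\<forall>B\<in>orbits D (verts G) \<phi>. card B = n \<or> card B = 2 * n"
    and "dihedral_labelling D n \<sigma>\<^sub>1 \<sigma>\<^sub>2 G \<phi> s t z x y"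
    and "\<delta> \<in> divisors G" and "divisor_degree G \<delta> = 0"
  shows "\<delta> \<in> pullback_sum D \<sigma>\<^sub>1 \<sigma>\<^sub>2 G \<phi> \<psi> \<longleftrightarrow>
    [(\<Sum>i=1..int n. i * ((\<Sum>j=1..t. \<delta> (x i j)) + (\<Sum>j=1..t. \<delta> (y i j)) + (\<Sum>j=1..s. \<delta> (z i j)))) = 0]
      (mod int n) \<and>
    (\<forall>j\<in>{1..t}. [(\<Sum>i=1..int n. \<delta> (x i j)) = (\<Sum>i=1..int n. \<delta> (y i j))] (mod int n))"
proof -
  interpret dihedral_strands D G \<phi> n \<sigma>\<^sub>1 \<sigma>\<^sub>2 "strands s t" "strand_vertex z x y" swap_strand
    using assms by (intro dihedral_labelling_imp_dihedral_strands)
      (auto simp: finite_loopless_graph_def connected_graph_def harmonic_action_def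
        graph_action_def)
  have "weight \<delta> = (\<Sum>i=1..int n. \<Sum>a\<in>strands s t. i * \<delta> (strand_vertex z x y a i))"
    unfolding weight_def by (rule sum.swap)
  then have "weight \<delta> = (\<Sum>i=1..int n. i *
      ((\<Sum>j=1..t. \<delta> (x i j)) + (\<Sum>j=1..t. \<delta> (y i j)) + (\<Sum>j=1..s. \<delta> (z i j))))"
    by (simp add: sum_strands sum_distrib_left distrib_left)
  moreover have "balanced \<delta> \<longleftrightarrow>
      (\<forall>j\<in>{1..t}. [(\<Sum>i=1..int n. \<delta> (x i j)) = (\<Sum>i=1..int n. \<delta> (y i j))] (mod int n))"
    unfolding balanced_def strand_sum_def by (auto simp: strands_def ball_Un intro: cong_sym)
  ultimately show ?thesis
    using in_pullback_sum_iff[OF assms(8,9), of \<psi>] by simp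
qed

end
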